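(* Let $M\ge1$ and let $t$ be an integer with $t>2\log_2M$. Let $U,X,Y\le\mathbb F_2^n$ be subspaces whose sum $U\oplus X\oplus Y$ is an internal direct sum, with $\dim X=\dim Y=t$, and put $$H_0:=U\oplus X,\qquad H_1:=U\oplus Y,\qquad B:=U.$$ Consider any possibly randomized algorithm which receives only membership and exact uniform-sampling access to the common observation $B=U$, and which outputs either a subspace of $\mathbb F_2^n$ or $\mathsf{FAIL}$. For $i\in\{0,1\}$, let $\mathcal S_i$ be the event that its output $\widehat V$ is a subspace satisfying $$|\widehat V|\le|H_i|,\qquad\mathcal N_{\widehat V}(H_i)\le M.$$ Then $$\min\{\Pr[\mathcal S_0],\Pr[\mathcal S_1]\}\le\frac12 .$$
   Context: For a subspace $V\le\mathbb F_2^n$ and a set $S$, $\mathcal N_V(S)=\min\{|T|:S\subseteq T+V\}$ is the minimum number of $V$-cosets needed to cover $S$, where $T+V=\{t+v:t\in T,v\in V\}$. Access to $B$ means a deterministic membership oracle $x\mapsto\mathbf 1_B(x)$ and an oracle returning independent exactly uniform samples from $B$; the hidden set ($H_0$ or $H_1$) is not accessible, so the output distribution of the algorithm depends only on $B$ and is the same for both hidden instances. *)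

theory Defs
  imports
    "HOL-Analysis.Analysis"
    "HOL-Probability.Probability"
    "HOL-Library.Set_Algebras"
    "HOL-Library.Z2"
begin

text \<open>The space $F_2^n$ is \<open>bit ^ 'n\<close>, subspaces and dimension over \<open>bit\<close> are
  \<open>vec.subspace\<close> and \<open>vec.dim\<close>, and \<open>S + T\<close> on sets is the elementwise sum.\<close>

definition internal_direct_sum3 ::
    "(bit ^ 'n) set \<Rightarrow> (bit ^ 'n) set \<Rightarrow> (bit ^ 'n) set \<Rightarrow> bool" where
  "internal_direct_sum3 U X Y \<longleftrightarrow>
     (\<forall>u\<in>U. \<forall>x\<in>X. \<forall>y\<in>Y. \<forall>u'\<in>U. \<forall>x'\<in>X. \<forall>y'\<in>Y.
        u + x + y = u' + x' + y' \<longrightarrow> u = u' \<and> x = x' \<and> y = y')"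

text \<open>The infimum is a minimum: \<open>T = S\<close> is admissible whenever \<open>0 \<in> V\<close>.\<close>

definition covering_number :: "(bit ^ 'n) set \<Rightarrow> (bit ^ 'n) set \<Rightarrow> nat" where
  "covering_number V S = Inf {card T | T. finite T \<and> S \<subseteq> T + V}"

text \<open>Algorithms with oracle access are possibly infinite interaction trees: each step outputs a
  result, queries the membership oracle, requests a sample, or makes an internal random choice.
  The oracles enter only through \<open>run\<close>, so a tree cannot depend on the observed set in any
  other way.\<close>

codatatype ('x, 'o) oracle_alg =
    Output 'o
  | Member 'x "bool \<Rightarrow> ('x, 'o) oracle_alg"
  | Sample "'x \<Rightarrow> ('x, 'o) oracle_alg"
  | Random "nat pmf" "nat \<Rightarrow> ('x, 'o) oracle_alg"

text \<open>The result is a subprobability distribution; the missing mass is the probability of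
  non-termination.\<close>

partial_function (spmf) run ::
    "('x \<Rightarrow> bool) \<Rightarrow> 'x spmf \<Rightarrow> ('x, 'o) oracle_alg \<Rightarrow> 'o spmf" where
  "run mem samp A = (case A of
      Output r \<Rightarrow> return_spmf r
    | Member x k \<Rightarrow> run mem samp (k (mem x))
    | Sample k \<Rightarrow> bind_spmf samp (\<lambda>x. run mem samp (k x))
    | Random p k \<Rightarrow> bind_spmf (spmf_of_pmf p) (\<lambda>i. run mem samp (k i)))"

text \<open>\<open>spmf_of_set B\<close> is the uniform distribution for finite nonempty \<open>B\<close>; subspaces of
  \<open>bit ^ 'n\<close> are always of this kind.\<close>

definition run_on :: "'x set \<Rightarrow> ('x, 'o) oracle_alg \<Rightarrow> 'o spmf" where
  "run_on B A = run (\<lambda>x. x \<in> B) (spmf_of_set B) A"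

datatype 'x outcome = FAIL | Found "'x set"

text \<open>An outcome \<open>Found V\<close> with \<open>V\<close> not a subspace is allowed, but never counts as a success.\<close>

definition success_event :: "(bit ^ 'n) set \<Rightarrow> real \<Rightarrow> (bit ^ 'n) outcome set" where
  "success_event H M =
     {Found V | V. vec.subspace V \<and> card V \<le> card H \<and> real (covering_number V H) \<le> M}"

definition success_prob ::
    "(bit ^ 'n, (bit ^ 'n) outcome) oracle_alg \<Rightarrow> (bit ^ 'n) set \<Rightarrow> (bit ^ 'n) set \<Rightarrow> real \<Rightarrow> real" where
  "success_prob A B H M = measure (measure_spmf (run_on B A)) (success_event H M)"

end

theory Submission
  imports Defs
begin

text \<open>No algorithm can produce a subspace \<open>V\<close> that succeeds for both instances: if
  \<open>U + X\<close> and \<open>U + Y\<close> were both covered by at most \<open>M\<close> cosets of \<open>V\<close>, then the sums of the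
  coset representatives would cover \<open>U + X + Y\<close> by at most \<open>M\<^sup>2\<close> cosets, so that
  \<open>|U| |X| |Y| \<le> M\<^sup>2 |V| \<le> M\<^sup>2 |U| |X|\<close> and \<open>2 ^ t = |Y| \<le> M\<^sup>2\<close>. Both instances induce the
  same output distribution, hence the two success events are disjoint events of one
  subprobability space.\<close>

text \<open>Makes \<open>bit ^ 'n\<close> a finite type, so every set of vectors is finite and
  \<open>card\<close> is its true size.\<close>

instance bit :: finite
proof
  have "(UNIV :: bit set) \<subseteq> {0, 1}"
    using bit_not_zero_iff by blast
  then show "finite (UNIV :: bit set)"
    by (rule finite_subset) simp
qed

lemma card_set_plus_le:
  fixes S T :: "'a::plus set"
  assumes "finite S" "finite T"
  shows "card (S + T) \<le> card S * card T"
proof -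
  have "card ((\<lambda>(x, y). x + y) ` (S \<times> T)) \<le> card (S \<times> T)"
    using assms by (intro card_image_le) simp
  then show ?thesis
    by (simp add: set_plus_image card_cartesian_product)
qed

text \<open>Induction on the basis: the only scalars are 0 and 1, so adjoining \<open>b\<close> adds
  to the span just its translate by \<open>b\<close>, and the size doubles.\<close>

lemma card_span_independent_bit:
  fixes S :: "(bit ^ 'n) set"
  assumes "vec.independent S"
  shows "card (vec.span S) = 2 ^ card S"
proof -
  have "finite S" by simp
  then show ?thesis
    using assms
  proof induction
    case empty
    show ?case by simp
  next
    case (insert b S)
    have indep: "vec.independent S" and b: "b \<notin> vec.span S"
      using insert.prems insert.hyps by (auto simp: vec.independent_insert)
    have "x \<in> vec.span S \<union> (+) b ` vec.span S \<longleftrightarrow> x \<in> vec.span (insert b S)" for x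
    proof -
      have "x \<in> vec.span (insert b S) \<longleftrightarrow> (\<exists>k::bit. x - k *s b \<in> vec.span S)"
        by (simp add: vec.span_insert)
      also have "\<dots> \<longleftrightarrow> x \<in> vec.span S \<or> x - b \<in> vec.span S"
      proof
        assume "\<exists>k::bit. x - k *s b \<in> vec.span S"
        then obtain k :: bit where "x - k *s b \<in> vec.span S" ..
        then show "x \<in> vec.span S \<or> x - b \<in> vec.span S"
          by (cases k) simp_all
      next
        assume "x \<in> vec.span S \<or> x - b \<in> vec.span S"
        then have "x - 0 *s b \<in> vec.span S \<or> x - 1 *s b \<in> vec.span S"
          by simp
        then show "\<exists>k::bit. x - k *s b \<in> vec.span S"
          by blast
      qed
      also have "x - b \<in> vec.span S \<longleftrightarrow> x \<in> (+) b ` vec.span S"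
      proof
        assume "x - b \<in> vec.span S"
        then have "b + (x - b) \<in> (+) b ` vec.span S"
          by (rule imageI)
        then show "x \<in> (+) b ` vec.span S"
          by (simp only: add_diff_eq add_diff_cancel_left')
      next
        assume "x \<in> (+) b ` vec.span S"
        then obtain y where "y \<in> vec.span S" "x = b + y" ..
        then show "x - b \<in> vec.span S"
          by (simp only: add_diff_cancel_left')
      qed
      finally show ?thesis by blast
    qed
    then have "vec.span (insert b S) = vec.span S \<union> (+) b ` vec.span S"
      by blast
    \<comment> \<open>If \<open>b + y\<close> and \<open>y\<close> both lay in the span, so would
      \<open>b\<close>, against independence.\<close>
    moreover have "vec.span S \<inter> (+) b ` vec.span S = {}"
      using b by (auto simp: vec.span_add_eq2)
    ultimately have "card (vec.span (insert b S)) = 2 * card (vec.span S)"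
      by (simp add: card_Un_disjoint card_image)
    then show ?case
      using insert indep by simp
  qed
qed

lemma card_subspace_bit:
  fixes V :: "(bit ^ 'n) set"
  assumes "vec.subspace V"
  shows "card V = 2 ^ vec.dim V"
proof -
  obtain S where "S \<subseteq> V" "vec.independent S" "V \<subseteq> vec.span S" "card S = vec.dim V"
    using vec.basis_exists by blast
  moreover from this have "vec.span S = V"
    using assms vec.span_subspace by blast
  ultimately show ?thesis
    using card_span_independent_bit by metis
qed

lemma covering_number_attained:
  fixes V S :: "(bit ^ 'n) set"
  assumes "0 \<in> V"
  obtains T where "S \<subseteq> T + V" "card T = covering_number V S"
proof -
  have "S \<subseteq> S + V"
    using assms by (metis set_zero_plus2 add.commute)
  then have "{card T | T. finite T \<and> S \<subseteq> T + V} \<noteq> {}"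
    using finite[of S] by blast
  then have "covering_number V S \<in> {card T | T. finite T \<and> S \<subseteq> T + V}"
    unfolding covering_number_def by (rule Inf_nat_def1)
  then show ?thesis
    using that by auto
qed

lemma subspace_plus_self:
  assumes "vec.subspace V"
  shows "V + V = V"
  using assms vec.subspace_0[OF assms] set_zero_plus2[of V V]
  by (auto elim!: set_plus_elim intro: vec.subspace_add)

lemma card_plus_le_covering_numbers:
  fixes V S S' :: "(bit ^ 'n) set"
  assumes "vec.subspace V"
  shows "card (S + S') \<le> covering_number V S * covering_number V S' * card V"
proof -
  have "0 \<in> V"
    using assms by (rule vec.subspace_0)
  obtain T where T: "S \<subseteq> T + V" "card T = covering_number V S"
    using covering_number_attained[OF \<open>0 \<in> V\<close>] .
  obtain T' where T': "S' \<subseteq> T' + V" "card T' = covering_number V S'"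
    using covering_number_attained[OF \<open>0 \<in> V\<close>] .
  have "S + S' \<subseteq> (T + V) + (T' + V)"
    using T(1) T'(1) by (rule set_plus_mono2)
  \<comment> \<open>The two copies of \<open>V\<close> merge because \<open>V + V = V\<close>, which
    leaves \<open>T + T'\<close> as a set of coset representatives.\<close>
  also have "\<dots> = (T + T') + V"
    using subspace_plus_self[OF assms] by (metis add.assoc add.commute)
  finally have "card (S + S') \<le> card ((T + T') + V)"
    by (intro card_mono) simp
  also have "\<dots> \<le> card (T + T') * card V"
    by (simp add: card_set_plus_le)
  also have "\<dots> \<le> card T * card T' * card V"
    by (simp add: card_set_plus_le)
  finally show ?thesis
    using T(2) T'(2) by simp
qed

text \<open>Directness is exactly injectivity of the addition map on the product of the three
  sets.\<close>

lemma card_internal_direct_sum3: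
  assumes "internal_direct_sum3 U X Y"
  shows "card (U + X + Y) = card U * card X * card Y"
proof -
  have "U + X + Y = (\<lambda>(u, x, y). u + x + y) ` (U \<times> X \<times> Y)"
    by (auto simp: set_plus_def image_iff) blast+
  moreover have "inj_on (\<lambda>(u, x, y). u + x + y) (U \<times> X \<times> Y)"
    using assms unfolding internal_direct_sum3_def inj_on_def by (clarsimp; blast)
  ultimately show ?thesis
    by (simp add: card_image card_cartesian_product)
qed

lemma success_events_disjoint:
  fixes U X Y :: "(bit ^ 'n) set" and M :: real
  assumes "vec.subspace U" "vec.subspace X" "vec.subspace Y"
    and "internal_direct_sum3 U X Y" and "M\<^sup>2 < card Y"
  shows "success_event (U + X) M \<inter> success_event (U + Y) M = {}"
proof (rule ccontr)
  assume "\<not> ?thesis"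
  then obtain V where V: "vec.subspace V" "card V \<le> card (U + X)"
    and M: "covering_number V (U + X) \<le> M" "covering_number V (U + Y) \<le> M"
    by (auto simp: success_event_def)
  have pos: "card U > 0" "card X > 0"
    using assms(1,2)[THEN vec.subspace_0] by (auto simp: card_gt_0_iff)
  \<comment> \<open>\<open>U + U = U\<close> splits the triple sum into the two hidden subspaces,
    each covered by few cosets of \<open>V\<close>.\<close>
  have "U + X + Y = (U + X) + (U + Y)"
    using subspace_plus_self[OF assms(1)] by (metis add.assoc add.commute)
  then have "card U * card X * card Y
      \<le> covering_number V (U + X) * covering_number V (U + Y) * card V"
    using card_plus_le_covering_numbers[OF V(1)] card_internal_direct_sum3[OF assms(4)]
    by metis
  also have "\<dots> \<le> covering_number V (U + X) * covering_number V (U + Y) * (card U * card X)"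
    using V(2) card_set_plus_le[of U X] by (intro mult_left_mono) auto
  finally have "card Y \<le> covering_number V (U + X) * covering_number V (U + Y)"
    using pos by (simp add: ac_simps)
  then have "real (card Y) \<le> real (covering_number V (U + X)) * real (covering_number V (U + Y))"
    by (metis of_nat_le_iff of_nat_mult)
  \<comment> \<open>Multiplying the two bounds requires \<open>0 \<le> M\<close>, which holds
    because a natural number lies below \<open>M\<close>.\<close>
  also have "\<dots> \<le> M * M"
    using M order_trans[OF of_nat_0_le_iff M(1)] by (intro mult_mono) auto
  finally show False
    using assms(5) by (simp add: power2_eq_square)
qed

theorem corollary9p3:
  fixes M :: real and t :: int
    and U X Y H0 H1 B :: "(bit ^ 'n) set"
    and A :: "(bit ^ 'n, (bit ^ 'n) outcome) oracle_alg"
  assumes "M \<ge> 1"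
    and "real_of_int t > 2 * log 2 M"
    and "vec.subspace U" and "vec.subspace X" and "vec.subspace Y"
    and "internal_direct_sum3 U X Y"
    and "int (vec.dim X) = t" and "int (vec.dim Y) = t"
    and "H0 = U + X" and "H1 = U + Y" and "B = U"
  shows "min (success_prob A B H0 M) (success_prob A B H1 M) \<le> 1 / 2"
proof -
  \<comment> \<open>The condition on \<open>t\<close> in logarithmic form; exponentiating turns it
    into \<open>M\<^sup>2 < 2 ^ t\<close>, the size of \<open>Y\<close>.\<close>
  have "log 2 (M\<^sup>2) < real (vec.dim Y)"
    using assms(1,2,8) by (auto simp: log_nat_power)
  then have "M\<^sup>2 < 2 powr real (vec.dim Y)"
    using assms(1) by (subst (asm) log_less_iff) auto
  then have "M\<^sup>2 < card Y"
    by (simp add: card_subspace_bit[OF assms(5)] powr_realpow)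
  then have disjoint: "success_event H0 M \<inter> success_event H1 M = {}"
    using success_events_disjoint[OF assms(3-6)] assms(9,10) by simp
  \<comment> \<open>Both probabilities are taken in the one distribution \<open>run_on B A\<close>,
    so disjointness makes them add up. Non-termination can only lower the total below 1, and the
    smaller of the two is at most half of it.\<close>
  have "success_prob A B H0 M + success_prob A B H1 M
      = measure (measure_spmf (run_on B A)) (success_event H0 M \<union> success_event H1 M)"
    unfolding success_prob_def
    using disjoint by (intro measure_spmf.finite_measure_Union[symmetric]) auto
  also have "\<dots> \<le> 1"
    by (rule measure_spmf.subprob_measure_le_1)
  finally show ?thesis
    by linarith
qed

end
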